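(* The following statements are true. (i) For a rational function $\psi$: $\psi\in\mathcal{GP}$ if and only if $\psi_{\rm even}\in\mathcal{GP}$. (ii) $\mathcal{GPE}$ is a sub-convex-invertible-cone of $\mathcal{GP}$ (i.e. $\mathcal{GPE}\subset\mathcal{GP}$ and $\mathcal{GPE}$ is itself a convex invertible cone). (iii) $\mathcal{GP}\cap\mathcal{E}ven$ (excluding the zero function) is a multiplicative group. (iv) For a rational function $g$: $g\in\mathcal{GPE}$ if and only if $g\cdot\mathcal{GP}\subset\mathcal{GP}$. (v) For arbitrary $\mathcal{GPE}$ functions $g_1(s)g_1^{\#}(s),\ldots,g_m(s)g_m^{\#}(s)$ (with $g_1,\dots,g_m$ rational), there always exists $\hat g\hat g^{\#}\in\mathcal{GPE}$, with $\hat g$ rational, so that $$\sum_{j=1}^m g_j(s)g_j^{\#}(s)=\hat g(s)\hat g^{\#}(s).$$ Moreover, if the $g_j$ are not all identically zero, one can always take $\hat g\in\overline{\mathcal{G}_+}$. (vi) Let $\psi$ be the composition function $\psi(s):=p(g(s))$ (whenever defined) where $g\in\mathcal{GPE}$ and $p\in\mathcal{P}$. Then $\psi\in\mathcal{GP}$. If in addition $p$ leaves the real axis invariant (e.g. $p$ is real), then $\psi\in\mathcal{GPE}$.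
   Context: All functions are scalar rational functions of a complex variable $s$ with complex coefficients. $\mathbb{C}_+=\{\operatorname{Re}s>0\}$, $\mathbb{C}_-=\{\operatorname{Re}s<0\}$. For a rational function $f$, $f^{\#}(s):=(f(-s^* ))^*$, where $^*$ is complex conjugation, and $f_{\rm even}:=\tfrac12(f+f^{\#})$. $\mathcal{E}ven$ is the set of rational functions $f$ with $f=f_{\rm even}$. $\mathcal{P}$ (positive functions) is the set of rational functions analytic in $\mathbb{C}_+$ with $\operatorname{Re}p(s)\ge0$ for all $s\in\mathbb{C}_+$. $\mathcal{GP}$ (generalized positive functions) is the set of rational functions $\psi$ with $\operatorname{Re}\psi(s)\ge0$ for all $s\in i\mathbb{R}$ which are not poles of $\psi$. $\mathcal{GPE}:=\mathcal{GP}\cap\mathcal{E}ven$. $\overline{\mathcal{G}_+}$ is the set of nonzero rational functions $g$ such that both $g$ and $g^{-1}$ are analytic in $\mathbb{C}_-$. A convex invertible cone is a set closed under multiplication by positive scalars, under addition, and under inversion $f\mapsto1/f$ (whenever the inverse exists, i.e. $f\not\equiv0$, it also belongs to the set). "$p$ leaves the real axis invariant" means $p(x)\in\mathbb{R}$ for every $x\in\mathbb{R}$ which is not a pole of $p$. *)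

theory Defs
  imports
    "HOL-Complex_Analysis.Complex_Analysis"
    "HOL-Computational_Algebra.Computational_Algebra"
    "HOL-Computational_Algebra.Field_as_Ring"
    "HOL-Algebra.Group"
begin

text \<open>
  Rational functions are elements of the field of fractions of the complex polynomials, so equality,
  sums, products and inverses are those of rational functions and removable singularities are
  removed. Pointwise notions refer to the evaluation of the fraction in lowest terms; by the
  convention \<open>x / 0 = 0\<close> it takes the junk value 0 at the poles.
\<close>

type_synonym ratfun = "complex poly fract"

definition ratfun_eval :: "ratfun \<Rightarrow> complex \<Rightarrow> complex" where
  "ratfun_eval f s = poly (fst (quot_of_fract f)) s / poly (snd (quot_of_fract f)) s"

definition ratfun_const :: "complex \<Rightarrow> ratfun" where
  "ratfun_const c = to_fract [:c:]"

text \<open>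
  For a polynomial, \<open>p\<^sup>#(s) = (p(-s\<^sup>*))\<^sup>*\<close> is again a polynomial: conjugate the coefficients and
  substitute \<open>-s\<close>. The lemma \<open>ratfun_eval_sharp\<close> below confirms the pointwise formula for rational
  functions.
\<close>

definition poly_sharp :: "complex poly \<Rightarrow> complex poly" where
  "poly_sharp p = pcompose (map_poly cnj p) [:0, -1:]"

definition sharp :: "ratfun \<Rightarrow> ratfun" where
  "sharp f = to_fract (poly_sharp (fst (quot_of_fract f))) / to_fract (poly_sharp (snd (quot_of_fract f)))"

definition even_part :: "ratfun \<Rightarrow> ratfun" where
  "even_part f = ratfun_const (1 / 2) * (f + sharp f)"

definition Even :: "ratfun set" where
  "Even = {f. f = even_part f}"

definition Pos :: "ratfun set" where
  "Pos = {p. ratfun_eval p analytic_on {s. Re s > 0} \<and> (\<forall>s. Re s > 0 \<longrightarrow> Re (ratfun_eval p s) \<ge> 0)}"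

definition GP :: "ratfun set" where
  "GP = {\<psi>. \<forall>s. Re s = 0 \<and> \<not> is_pole (ratfun_eval \<psi>) s \<longrightarrow> Re (ratfun_eval \<psi> s) \<ge> 0}"

definition GPE :: "ratfun set" where
  "GPE = GP \<inter> Even"

definition Gplus_bar :: "ratfun set" where
  "Gplus_bar = {g. g \<noteq> 0 \<and> ratfun_eval g analytic_on {s. Re s < 0}
                        \<and> ratfun_eval (inverse g) analytic_on {s. Re s < 0}}"

definition convex_invertible_cone :: "ratfun set \<Rightarrow> bool" where
  "convex_invertible_cone C \<longleftrightarrow>
     (\<forall>c::real. \<forall>f\<in>C. c > 0 \<longrightarrow> ratfun_const (of_real c) * f \<in> C) \<and>
     (\<forall>f\<in>C. \<forall>g\<in>C. f + g \<in> C) \<and>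
     (\<forall>f\<in>C. f \<noteq> 0 \<longrightarrow> inverse f \<in> C)"

definition leaves_real_axis_invariant :: "ratfun \<Rightarrow> bool" where
  "leaves_real_axis_invariant p \<longleftrightarrow>
     (\<forall>x::real. \<not> is_pole (ratfun_eval p) (of_real x) \<longrightarrow> ratfun_eval p (of_real x) \<in> \<real>)"

text \<open>
  The composite \<open>p(g(s))\<close> as a rational function: substitute \<open>g\<close> into the numerator and the
  denominator of \<open>p\<close>. It is undefined exactly when \<open>g\<close> is a constant that is a pole of \<open>p\<close>; see
  \<open>ratfun_comp_defined_iff\<close> and \<open>ratfun_eval_comp\<close> for the pointwise description.
\<close>

definition poly_subst :: "complex poly \<Rightarrow> ratfun \<Rightarrow> ratfun" where
  "poly_subst q g = poly (map_poly ratfun_const q) g"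

definition ratfun_comp_defined :: "ratfun \<Rightarrow> ratfun \<Rightarrow> bool" where
  "ratfun_comp_defined p g \<longleftrightarrow> poly_subst (snd (quot_of_fract p)) g \<noteq> 0"

definition ratfun_comp :: "ratfun \<Rightarrow> ratfun \<Rightarrow> ratfun" where
  "ratfun_comp p g = poly_subst (fst (quot_of_fract p)) g / poly_subst (snd (quot_of_fract p)) g"


lemma ratfun_eval_eqI:
  assumes f: "f = to_fract a / to_fract b" and b: "poly b s \<noteq> 0"
  shows "poly (snd (quot_of_fract f)) s \<noteq> 0 \<and> ratfun_eval f s = poly a s / poly b s"
proof -
  have b0: "b \<noteq> 0" using b by auto
  have "quot_of_fract f = normalize_quot (a, b)"
    using quot_of_fract_quot_to_fract[of "(a, b)"] f by (simp add: quot_to_fract_def Fract_conv_to_fract)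
  moreover from normalize_quotE[OF b0, of a] obtain d where
    "a = fst (normalize_quot (a,b)) * d" "b = snd (normalize_quot (a,b)) * d" by metis
  ultimately have "a = fst (quot_of_fract f) * d" "b = snd (quot_of_fract f) * d" by simp_all
  thus ?thesis using b by (auto simp: ratfun_eval_def poly_mult)
qed

lemma ratfun_quot: "f = to_fract (fst (quot_of_fract f)) / to_fract (snd (quot_of_fract f))"
  using quot_to_fract_quot_of_fract[of f]
  by (simp add: quot_to_fract_def Fract_conv_to_fract case_prod_unfold)

lemma coprime_quot: "coprime (fst (quot_of_fract f)) (snd (quot_of_fract f))"
  using quot_of_fract_in_normalized_fracts[of f] by (auto simp: normalized_fracts_def case_prod_unfold)

lemma no_common_root:
  assumes "coprime a b" "poly b s = 0"
  shows "poly a s \<noteq> (0::complex)"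
proof
  assume "poly a s = 0"
  with assms(2) have "[:-s, 1:] dvd a" "[:-s, 1:] dvd b" by (simp_all add: poly_eq_0_iff_dvd)
  with assms(1) have "is_unit [:-s, 1:]" by (meson coprime_common_divisor)
  thus False by (simp add: is_unit_pCons_iff)
qed

lemma is_pole_ratfun_iff: "is_pole (ratfun_eval f) s \<longleftrightarrow> poly (snd (quot_of_fract f)) s = 0"
proof
  let ?a = "fst (quot_of_fract f)" and ?b = "snd (quot_of_fract f)"
  have ev: "ratfun_eval f = (\<lambda>s. poly ?a s / poly ?b s)" by (simp add: ratfun_eval_def fun_eq_iff)
  {
    assume z: "poly ?b s = 0"
    have "finite {x. poly ?b x = 0}" by (rule poly_roots_finite) simp
    hence "\<not> s islimpt {x. poly ?b x = 0}" by (rule islimpt_finite)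
    hence "\<forall>\<^sub>F x in at s. poly ?b x \<noteq> 0"
      by (simp add: islimpt_iff_eventually)
    thus "is_pole (ratfun_eval f) s"
      unfolding is_pole_def ev using z no_common_root[OF coprime_quot z]
      by (intro filterlim_divide_at_infinity[of _ "poly ?a s"])
         (auto simp: filterlim_at intro!: tendsto_eq_intros)
  }
  {
    assume p: "is_pole (ratfun_eval f) s"
    show "poly ?b s = 0"
    proof (rule ccontr)
      assume "poly ?b s \<noteq> 0"
      hence "(ratfun_eval f \<longlongrightarrow> poly ?a s / poly ?b s) (at s)"
        unfolding ev by (intro tendsto_intros) auto
      with p show False unfolding is_pole_def using not_tendsto_and_filterlim_at_infinity[of "at s"] by auto
    qed
  }
qed

lemma poly_poly_sharp: "poly (poly_sharp p) s = cnj (poly p (- cnj s))"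
  by (simp add: poly_sharp_def poly_pcompose)

lemma ratfun_eval_sharp:
  assumes "\<not> is_pole (ratfun_eval f) (- cnj s)"
  shows "\<not> is_pole (ratfun_eval (sharp f)) s \<and> ratfun_eval (sharp f) s = cnj (ratfun_eval f (- cnj s))"
  using assms ratfun_eval_eqI[OF sharp_def, of f s]
  by (simp add: is_pole_ratfun_iff poly_poly_sharp ratfun_eval_def)

lemma ratfun_eval_add:
  assumes "\<not> is_pole (ratfun_eval f) s" "\<not> is_pole (ratfun_eval g) s"
  shows "\<not> is_pole (ratfun_eval (f + g)) s \<and> ratfun_eval (f + g) s = ratfun_eval f s + ratfun_eval g s"
proof -
  define a b c d where "a = fst (quot_of_fract f)" and "b = snd (quot_of_fract f)"
    and "c = fst (quot_of_fract g)" and "d = snd (quot_of_fract g)"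
  have nz: "poly b s \<noteq> 0" "poly d s \<noteq> 0"
    using assms by (simp_all add: is_pole_ratfun_iff b_def d_def)
  have "f = to_fract a / to_fract b" "g = to_fract c / to_fract d" "b \<noteq> 0" "d \<noteq> 0"
    unfolding a_def b_def c_def d_def by (rule ratfun_quot)+ simp_all
  hence "f + g = to_fract (a * d + c * b) / to_fract (b * d)"
    by (simp add: add_frac_eq)
  from ratfun_eval_eqI[OF this, of s] show ?thesis using nz
    by (simp add: is_pole_ratfun_iff ratfun_eval_def a_def b_def c_def d_def add_frac_eq)
qed

lemma ratfun_eval_mult:
  assumes "\<not> is_pole (ratfun_eval f) s" "\<not> is_pole (ratfun_eval g) s"
  shows "\<not> is_pole (ratfun_eval (f * g)) s \<and> ratfun_eval (f * g) s = ratfun_eval f s * ratfun_eval g s"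
proof -
  define a b c d where "a = fst (quot_of_fract f)" and "b = snd (quot_of_fract f)"
    and "c = fst (quot_of_fract g)" and "d = snd (quot_of_fract g)"
  have nz: "poly b s \<noteq> 0" "poly d s \<noteq> 0"
    using assms by (simp_all add: is_pole_ratfun_iff b_def d_def)
  have "f = to_fract a / to_fract b" "g = to_fract c / to_fract d"
    unfolding a_def b_def c_def d_def by (rule ratfun_quot)+
  hence "f * g = to_fract (a * c) / to_fract (b * d)" by simp
  from ratfun_eval_eqI[OF this, of s] show ?thesis using nz
    by (simp add: is_pole_ratfun_iff ratfun_eval_def a_def b_def c_def d_def)
qed

lemma ratfun_eval_const:
  "\<not> is_pole (ratfun_eval (ratfun_const c)) s" "ratfun_eval (ratfun_const c) s = c"
  by (simp_all only: is_pole_ratfun_iff ratfun_eval_def ratfun_const_def quot_of_fract_to_fract) simp_all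

lemma ratfun_eval_divide:
  assumes "\<not> is_pole (ratfun_eval f) s" "\<not> is_pole (ratfun_eval g) s" "ratfun_eval g s \<noteq> 0"
  shows "\<not> is_pole (ratfun_eval (f / g)) s \<and> ratfun_eval (f / g) s = ratfun_eval f s / ratfun_eval g s"
proof -
  define a b c d where "a = fst (quot_of_fract f)" and "b = snd (quot_of_fract f)"
    and "c = fst (quot_of_fract g)" and "d = snd (quot_of_fract g)"
  have nz: "poly b s \<noteq> 0" "poly d s \<noteq> 0" "poly c s \<noteq> 0"
    using assms by (auto simp: is_pole_ratfun_iff b_def d_def c_def ratfun_eval_def)
  have "f = to_fract a / to_fract b" "g = to_fract c / to_fract d"
    unfolding a_def b_def c_def d_def by (rule ratfun_quot)+
  hence "f / g = to_fract (a * d) / to_fract (b * c)" by simp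
  from ratfun_eval_eqI[OF this, of s] show ?thesis using nz
    by (simp add: is_pole_ratfun_iff ratfun_eval_def a_def b_def c_def d_def)
qed

lemma ratfun_eval_poly_subst:
  assumes "\<not> is_pole (ratfun_eval g) s"
  shows "\<not> is_pole (ratfun_eval (poly_subst q g)) s \<and>
         ratfun_eval (poly_subst q g) s = poly q (ratfun_eval g s)"
proof (induction q)
  case 0
  show ?case using ratfun_eval_const[of 0 s] by (simp add: poly_subst_def ratfun_const_def)
next
  case (pCons c q)
  have "poly_subst (pCons c q) g = ratfun_const c + g * poly_subst q g"
    using pCons.hyps by (simp add: poly_subst_def map_poly_pCons ratfun_const_def)
  thus ?case
    using ratfun_eval_add ratfun_eval_mult ratfun_eval_const assms pCons.IH by simp
qed

lemma ratfun_eval_comp: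
  assumes "\<not> is_pole (ratfun_eval g) s" "\<not> is_pole (ratfun_eval p) (ratfun_eval g s)"
  shows "\<not> is_pole (ratfun_eval (ratfun_comp p g)) s \<and>
         ratfun_eval (ratfun_comp p g) s = ratfun_eval p (ratfun_eval g s)"
proof -
  have "poly (snd (quot_of_fract p)) (ratfun_eval g s) \<noteq> 0"
    using assms(2) by (simp add: is_pole_ratfun_iff)
  thus ?thesis
    using ratfun_eval_poly_subst[OF assms(1)] 
    by (simp add: ratfun_comp_def ratfun_eval_divide ratfun_eval_def[of p])
qed

lemma ratfun_comp_defined_iff:
  "ratfun_comp_defined p g \<longleftrightarrow>
     (\<exists>s. \<not> is_pole (ratfun_eval g) s \<and> \<not> is_pole (ratfun_eval p) (ratfun_eval g s))"
proof
  define h where "h = poly_subst (snd (quot_of_fract p)) g"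
  assume "ratfun_comp_defined p g"
  hence "h \<noteq> 0" by (simp add: ratfun_comp_defined_def h_def)
  hence "fst (quot_of_fract h) \<noteq> 0" using ratfun_quot[of h] by auto
  hence "fst (quot_of_fract h) * snd (quot_of_fract h) * snd (quot_of_fract g) \<noteq> 0" by simp
  hence "finite {s. poly (fst (quot_of_fract h) * snd (quot_of_fract h) * snd (quot_of_fract g)) s = 0}"
    by (rule poly_roots_finite)
  then obtain s where "poly (fst (quot_of_fract h) * snd (quot_of_fract h) * snd (quot_of_fract g)) s \<noteq> 0"
    using ex_new_if_finite[OF infinite_UNIV_char_0] by blast
  hence "\<not> is_pole (ratfun_eval g) s" "ratfun_eval h s \<noteq> 0"
    by (simp_all add: is_pole_ratfun_iff ratfun_eval_def)
  moreover from this have "\<not> is_pole (ratfun_eval p) (ratfun_eval g s)"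
    using ratfun_eval_poly_subst[of g s] by (simp add: is_pole_ratfun_iff h_def)
  ultimately show "\<exists>s. \<not> is_pole (ratfun_eval g) s \<and> \<not> is_pole (ratfun_eval p) (ratfun_eval g s)"
    by blast
next
  assume "\<exists>s. \<not> is_pole (ratfun_eval g) s \<and> \<not> is_pole (ratfun_eval p) (ratfun_eval g s)"
  then obtain s where s: "\<not> is_pole (ratfun_eval g) s" "\<not> is_pole (ratfun_eval p) (ratfun_eval g s)"
    by blast
  have "ratfun_eval (poly_subst (snd (quot_of_fract p)) g) s \<noteq> 0"
    using ratfun_eval_poly_subst[OF s(1)] s(2) by (simp add: is_pole_ratfun_iff)
  thus "ratfun_comp_defined p g"
    by (auto simp: ratfun_comp_defined_def ratfun_eval_def)
qed

end

theory Submission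
  imports Defs
begin

text \<open>
  A rational function is determined by its values at all but finitely many points of the imaginary
  axis, where sums, products, inverses and \<open>f\<^sup>#\<close> (complex conjugation there) are computed pointwise.
  By continuity, \<open>GP\<close> consists of the functions with nonnegative real part at almost all points of
  the axis, \<open>Even\<close> of those that are real there, and \<open>GPE\<close> of those with values in \<open>[0, \<infinity>)\<close>.
  All parts except (v) are then pointwise. Part (v) is a Fejer-Riesz factorization: a polynomial
  that is nonnegative on the axis splits into linear factors that come in mirror pairs with respect
  to the axis, and one keeps from each pair the root in the closed right half-plane.
\<close>

section \<open>Pointwise calculus on the imaginary axis\<close>

abbreviation axis_eval :: "ratfun \<Rightarrow> real \<Rightarrow> complex" where
  "axis_eval f t \<equiv> ratfun_eval f (\<i> * of_real t)"

lemma eventually_cofinite_poly_axis_neq_0: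
  assumes "q \<noteq> (0 :: complex poly)"
  shows "\<forall>\<^sub>F t::real in cofinite. poly q (\<i> * of_real t) \<noteq> 0"
proof -
  have "inj (\<lambda>t::real. \<i> * of_real t)"
    by (auto simp: inj_on_def)
  hence "finite ((\<lambda>t::real. \<i> * of_real t) -` {s. poly q s = 0})"
    using poly_roots_finite[OF assms] by (intro finite_vimageI)
  thus ?thesis
    by (simp add: eventually_cofinite vimage_def)
qed

lemma eventually_cofinite_axis_not_pole:
  "\<forall>\<^sub>F t::real in cofinite. \<not> is_pole (ratfun_eval f) (\<i> * of_real t)"
  unfolding is_pole_ratfun_iff by (rule eventually_cofinite_poly_axis_neq_0) simp

lemma eventually_cofinite_axis_eval_neq_0:
  assumes "f \<noteq> 0"
  shows "\<forall>\<^sub>F t in cofinite. axis_eval f t \<noteq> 0"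
proof -
  have "fst (quot_of_fract f) \<noteq> 0"
    using ratfun_quot[of f] assms by auto
  from eventually_cofinite_poly_axis_neq_0[OF this] eventually_cofinite_axis_not_pole[of f]
  show ?thesis
    by eventually_elim (simp add: is_pole_ratfun_iff ratfun_eval_def)
qed

lemma axis_eval_add:
  "\<forall>\<^sub>F t in cofinite. axis_eval (f + g) t = axis_eval f t + axis_eval g t"
  using eventually_cofinite_axis_not_pole[of f] eventually_cofinite_axis_not_pole[of g]
  by eventually_elim (simp add: ratfun_eval_add)

lemma axis_eval_mult:
  "\<forall>\<^sub>F t in cofinite. axis_eval (f * g) t = axis_eval f t * axis_eval g t"
  using eventually_cofinite_axis_not_pole[of f] eventually_cofinite_axis_not_pole[of g]
  by eventually_elim (simp add: ratfun_eval_mult)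

lemma ratfun_eval_0 [simp]: "ratfun_eval 0 s = 0"
  using ratfun_eval_const(2)[of 0 s] by (simp add: ratfun_const_def)

lemma ratfun_eval_1 [simp]: "ratfun_eval 1 s = 1"
  using ratfun_eval_const(2)[of 1 s] by (simp add: ratfun_const_def flip: one_pCons)

text \<open>Evaluating the identity \<open>f * inverse f = 1\<close> makes the two values mutually
  inverse; that they are nonzero comes with it.\<close>

lemma axis_eval_inverse:
  assumes "f \<noteq> 0"
  shows "\<forall>\<^sub>F t in cofinite. axis_eval (inverse f) t = inverse (axis_eval f t)"
proof -
  have 1: "f * inverse f = 1"
    using assms by simp
  show ?thesis
    using axis_eval_mult[of f "inverse f"] 
    by eventually_elim (unfold 1, metis inverse_unique ratfun_eval_1)
qed

text \<open>The reflection s -> -s^* fixes every point of the axis, so only the outer conjugation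
  remains there.\<close>

lemma axis_eval_sharp:
  "\<forall>\<^sub>F t in cofinite. axis_eval (sharp f) t = cnj (axis_eval f t)"
  using eventually_cofinite_axis_not_pole[of f] 
  by eventually_elim (use ratfun_eval_sharp in fastforce)

lemma axis_eval_even_part:
  "\<forall>\<^sub>F t in cofinite. axis_eval (even_part f) t = of_real (Re (axis_eval f t))"
  using axis_eval_mult[of "ratfun_const (1/2)" "f + sharp f"] axis_eval_add[of f "sharp f"]
    axis_eval_sharp[of f]
  unfolding even_part_def
  by eventually_elim (simp add: ratfun_eval_const complex_add_cnj)

text \<open>A nonzero difference f - g would be nonzero at all but finitely many points of the
  infinite axis.\<close>

lemma ratfun_eqI_axis:
  assumes "\<forall>\<^sub>F t in cofinite. axis_eval f t = axis_eval g t"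
  shows "f = g"
proof (rule ccontr)
  assume "f \<noteq> g"
  hence "f - g \<noteq> 0" by simp
  note eventually_cofinite_axis_eval_neq_0[OF this] 
  moreover have "\<forall>\<^sub>F t in cofinite. axis_eval f t = axis_eval (f - g) t + axis_eval g t"
    using axis_eval_add[of "f - g" g] by simp
  ultimately have "\<forall>\<^sub>F t::real in cofinite. False"
    using assms by eventually_elim simp
  thus False
    by (simp add: eventually_cofinite infinite_UNIV_char_0)
qed

section \<open>Membership tests by values at almost all points of the axis\<close>

lemma ratfun_eval_tendsto:
  assumes "\<not> is_pole (ratfun_eval f) s"
  shows "(ratfun_eval f \<longlongrightarrow> ratfun_eval f s) (at s)"
proof -
  have ev: "ratfun_eval f = (\<lambda>s. poly (fst (quot_of_fract f)) s / poly (snd (quot_of_fract f)) s)"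
    by (simp add: ratfun_eval_def fun_eq_iff)
  have "poly (snd (quot_of_fract f)) s \<noteq> 0"
    using assms by (simp add: is_pole_ratfun_iff)
  thus ?thesis
    unfolding ev by (intro tendsto_intros)
qed

text \<open>A finite exceptional set has no limit points. This turns almost-everywhere statements
  into input for limit arguments.\<close>

lemma eventually_cofinite_imp_at:
  fixes t :: "'a :: t1_space"
  assumes "\<forall>\<^sub>F x in cofinite. P x"
  shows "\<forall>\<^sub>F x in at t. P x"
proof -
  have "finite {x. \<not> P x}"
    using assms by (simp add: eventually_cofinite)
  hence "\<not> t islimpt {x. \<not> P x}"
    by (rule islimpt_finite)
  thus ?thesis
    by (simp add: islimpt_iff_eventually)
qed

text \<open>Forwards, the finitely many poles are discarded. Backwards, f is continuous at a
  non-pole, which is approached along the axis through points where the inequality holds.\<close>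

lemma GP_iff: "f \<in> GP \<longleftrightarrow> (\<forall>\<^sub>F t in cofinite. Re (axis_eval f t) \<ge> 0)"
proof
  assume f: "f \<in> GP"
  show "\<forall>\<^sub>F t in cofinite. Re (axis_eval f t) \<ge> 0"
    using eventually_cofinite_axis_not_pole[of f]
    by eventually_elim (use f in \<open>auto simp: GP_def\<close>)
next
  assume ev: "\<forall>\<^sub>F t in cofinite. Re (axis_eval f t) \<ge> 0"
  have "Re (ratfun_eval f s) \<ge> 0" if s: "Re s = 0" "\<not> is_pole (ratfun_eval f) s" for s
  proof -
    have s_eq: "s = \<i> * of_real (Im s)"
      using s(1) by (simp add: complex_eq_iff)
    have lim: "filterlim (\<lambda>t. \<i> * of_real t) (at s) (at (Im s))"
      by (subst s_eq, rule filterlim_atI)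
         (auto intro!: tendsto_intros simp: eventually_at_filter)
    have "((\<lambda>t. Re (axis_eval f t)) \<longlongrightarrow> Re (ratfun_eval f s)) (at (Im s))"
      by (intro tendsto_Re filterlim_compose[OF ratfun_eval_tendsto[OF s(2)] lim])
    thus ?thesis
      using eventually_cofinite_imp_at[OF ev] by (rule tendsto_lowerbound) simp
  qed
  thus "f \<in> GP"
    by (auto simp: GP_def)
qed

text \<open>The even part of f takes the value Re f on the axis, so f agrees with it almost
  everywhere there exactly when f is real.\<close>

lemma Even_iff: "f \<in> Even \<longleftrightarrow> (\<forall>\<^sub>F t in cofinite. axis_eval f t \<in> \<real>)"
proof
  assume "f \<in> Even"
  hence "even_part f = f"
    by (simp add: Even_def)
  with axis_eval_even_part[of f] have
    "\<forall>\<^sub>F t in cofinite. axis_eval f t = of_real (Re (axis_eval f t))" by simp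
  thus "\<forall>\<^sub>F t in cofinite. axis_eval f t \<in> \<real>"
    by eventually_elim (metis Reals_of_real)
next
  assume "\<forall>\<^sub>F t in cofinite. axis_eval f t \<in> \<real>"
  with axis_eval_even_part[of f]
  have "\<forall>\<^sub>F t in cofinite. axis_eval f t = axis_eval (even_part f) t"
    by eventually_elim simp
  thus "f \<in> Even"
    unfolding Even_def by (blast intro: ratfun_eqI_axis)
qed

lemma GPE_iff: "f \<in> GPE \<longleftrightarrow> (\<forall>\<^sub>F t in cofinite. axis_eval f t \<in> \<real>\<^sub>\<ge>\<^sub>0)"
  by (simp add: GPE_def GP_iff Even_iff complex_nonneg_Reals_iff complex_is_Real_iff
      flip: eventually_conj_iff)

section \<open>Algebraic structure of \<open>GPE\<close>: cone, group and multipliers\<close>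

lemma GP_iff_even_part: "f \<in> GP \<longleftrightarrow> even_part f \<in> GP"
  unfolding GP_iff by (rule eventually_cong[OF axis_eval_even_part[of f]]) simp

lemma GPE_add: 
  assumes "f \<in> GPE" "g \<in> GPE"
  shows "f + g \<in> GPE"
  using axis_eval_add[of f g] assms unfolding GPE_iff
  by eventually_elim simp

lemma GPE_mult:
  assumes "f \<in> GPE" "g \<in> GPE"
  shows "f * g \<in> GPE"
  using axis_eval_mult[of f g] assms unfolding GPE_iff
  by eventually_elim simp

lemma GPE_const: "c \<in> \<real>\<^sub>\<ge>\<^sub>0 \<Longrightarrow> ratfun_const c \<in> GPE"
  by (simp add: GPE_iff ratfun_eval_const)

lemma GPE_0: "0 \<in> GPE" and GPE_1: "1 \<in> GPE"
  by (simp_all add: GPE_iff)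

lemma GPE_inverse:
  assumes "f \<in> GPE"
  shows "inverse f \<in> GPE"
\<comment> \<open>The zero function is covered by the convention
  \<open>inverse 0 = 0\<close>.\<close>
proof (cases "f = 0")
  case False
  show ?thesis
    using axis_eval_inverse[OF False] assms unfolding GPE_iff
    by eventually_elim simp
qed (simp add: GPE_0)

lemma GPE_sum:
  assumes "\<And>j. j \<in> A \<Longrightarrow> f j \<in> GPE"
  shows "sum f A \<in> GPE"
  using assms by (induction A rule: infinite_finite_induct) (auto intro: GPE_0 GPE_add)

lemma convex_invertible_cone_GPE: "convex_invertible_cone GPE"
  unfolding convex_invertible_cone_def
  by (auto intro!: GPE_add GPE_mult GPE_inverse GPE_const)

lemma group_GPE: "group \<lparr>carrier = GPE - {0}, monoid.mult = (*), one = 1\<rparr>"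
proof (rule groupI; simp)
  fix x assume "x \<in> GPE \<and> x \<noteq> 0"
  thus "\<exists>y\<in>GPE - {0}. y * x = 1"
    by (intro bexI[of _ "inverse x"]) (auto intro: GPE_inverse)
qed (auto intro: GPE_mult GPE_1 simp: mult.assoc)

text \<open>The converse tests the multiplier on the constants 1, \<open>\<i>\<close> and \<open>-\<i>\<close>.\<close>

lemma GPE_iff_multiplier: "g \<in> GPE \<longleftrightarrow> (\<lambda>\<psi>. g * \<psi>) ` GP \<subseteq> GP"
proof
  assume g: "g \<in> GPE"
  show "(\<lambda>\<psi>. g * \<psi>) ` GP \<subseteq> GP"
  proof safe
    fix \<psi> assume "\<psi> \<in> GP"
    with axis_eval_mult[of g \<psi>] g show "g * \<psi> \<in> GP"
      unfolding GP_iff GPE_iff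
      by eventually_elim (simp add: complex_nonneg_Reals_iff)
  qed
next
  assume sub: "(\<lambda>\<psi>. g * \<psi>) ` GP \<subseteq> GP"
  have *: "\<forall>\<^sub>F t in cofinite. Re (axis_eval g t * c) \<ge> 0" if "Re c = 0 \<or> c = 1" for c
  proof -
    have "ratfun_const c \<in> GP"
      using that by (auto simp: GP_iff ratfun_eval_const)
    hence "g * ratfun_const c \<in> GP"
      using sub by blast
    with axis_eval_mult[of g "ratfun_const c"] show ?thesis
      unfolding GP_iff by eventually_elim (simp add: ratfun_eval_const)
  qed
  \<comment> \<open>The constant 1 gives Re g >= 0; multiplying by i and -i gives -Im g >= 0 and Im
    g >= 0, so g is real.\<close>
  show "g \<in> GPE"
    unfolding GPE_iff using *[of 1, simplified] *[of "\<i>", simplified] *[of "-\<i>", simplified]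
    by eventually_elim (simp add: complex_nonneg_Reals_iff)
qed

section \<open>Spectral factorization of polynomials nonnegative on the axis\<close>

lemma poly_eqI_axis:
  fixes p q :: "complex poly"
  assumes "\<And>t::real. poly p (\<i> * of_real t) = poly q (\<i> * of_real t)"
  shows "p = q"
proof (rule ccontr)
  assume "p \<noteq> q"
  hence "p - q \<noteq> 0" by simp
  from eventually_cofinite_poly_axis_neq_0[OF this] assms show False
    by (simp add: eventually_cofinite infinite_UNIV_char_0)
qed

text \<open>Polynomials are continuous and the nonnegative reals are closed. This restores the
  points lost when dividing by a factor that may vanish on the axis.\<close>

lemma eventually_cofinite_poly_axis_nonneg:
  fixes p :: "complex poly"
  assumes "\<forall>\<^sub>F t::real in cofinite. poly p (\<i> * of_real t) \<in> \<real>\<^sub>\<ge>\<^sub>0"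
  shows "poly p (\<i> * of_real t) \<in> \<real>\<^sub>\<ge>\<^sub>0"
proof (rule Lim_in_closed_set)
  show "closed (\<real>\<^sub>\<ge>\<^sub>0 :: complex set)" by simp
  show "((\<lambda>t. poly p (\<i> * of_real t)) \<longlongrightarrow> poly p (\<i> * of_real t)) (at t)"
    by (intro tendsto_intros)
qed (use eventually_cofinite_imp_at[OF assms] in simp_all)

text \<open>On the axis one factor is minus the conjugate of the other, so a mirror pair contributes
  a squared modulus up to sign.\<close>

lemma mirror_factor_axis:
  "(\<i> * of_real t - z) * (\<i> * of_real t + cnj z) = - of_real ((norm (\<i> * of_real t - z))\<^sup>2)"
proof -
  have "\<i> * of_real t + cnj z = - cnj (\<i> * of_real t - z)" by simp
  thus ?thesis by (simp only: complex_norm_square mult_minus_right)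
qed

text \<open>A root off the axis is paired with its mirror image because \<open>p\<close> is real on the axis; a root
  on the axis is at least double because \<open>p\<close> does not change sign there.\<close>

lemma mirror_factor_dvd:
  fixes p :: "complex poly"
  assumes nonneg: "\<And>t::real. poly p (\<i> * of_real t) \<in> \<real>\<^sub>\<ge>\<^sub>0" and root: "poly p z = 0"
  shows "[:-z, 1:] * [:cnj z, 1:] dvd p"
proof -
  obtain r where r: "p = [:-z, 1:] * r"
    using root by (auto simp: poly_eq_0_iff_dvd)
  have "poly r (- cnj z) = 0"
  proof (cases "Re z = 0")
    case False
    have "poly_sharp p = p"
    proof (rule poly_eqI_axis)
      fix t :: real
      show "poly (poly_sharp p) (\<i> * of_real t) = poly p (\<i> * of_real t)"
        using nonneg[of t] by (simp add: poly_poly_sharp complex_eq_iff complex_nonneg_Reals_iff)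
    qed
    hence "poly p (- cnj z) = 0"
      using poly_poly_sharp[of p "- cnj z"] root by simp
    hence "(- cnj z - z) * poly r (- cnj z) = 0"
      by (simp add: r algebra_simps)
    moreover have "- cnj z - z \<noteq> 0"
      using False by (auto simp: complex_eq_iff)
    ultimately show ?thesis
      by (metis mult_eq_0_iff)
  next
    case True
    define t0 where "t0 = Im z"
    have z: "z = \<i> * of_real t0"
      using True by (simp add: complex_eq_iff t0_def)
    \<comment> \<open>Since p(it) = (t - t0) w(t), nonnegativity makes w real away from t0,
      nonnegative to the right of t0 and nonpositive to the left; continuity then forces w(t0) =
      0.\<close>
    define w where "w = (\<lambda>t::real. \<i> * poly r (\<i> * of_real t))"
    have w: "of_real (t - t0) * w t \<in> \<real>\<^sub>\<ge>\<^sub>0" for t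
      using nonneg[of t] by (simp add: r z w_def algebra_simps)
    have re: "t > t0 \<Longrightarrow> Re (w t) \<ge> 0" "t < t0 \<Longrightarrow> Re (w t) \<le> 0" for t
      using w[of t] by (auto simp: complex_nonneg_Reals_iff zero_le_mult_iff)
    have im: "Im (w t) = 0" if "t \<noteq> t0" for t
      using w[of t] that by (simp add: complex_nonneg_Reals_iff)
    have lim: "(w \<longlongrightarrow> w t0) (at t0 within A)" for A
      unfolding w_def by (intro tendsto_intros)
    have "((\<lambda>t. Im (w t)) \<longlongrightarrow> Im (w t0)) (at t0)"
      by (intro tendsto_intros lim)
    moreover have "((\<lambda>t. Im (w t)) \<longlongrightarrow> 0) (at t0)"
      by (rule tendsto_eventually) (auto simp: eventually_at_filter im)
    ultimately have 1: "Im (w t0) = 0"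
      using tendsto_unique[of "at t0"] by simp
    have 2: "Re (w t0) \<ge> 0"
    proof (rule tendsto_lowerbound)
      show "((\<lambda>t. Re (w t)) \<longlongrightarrow> Re (w t0)) (at_right t0)"
        by (intro tendsto_intros lim)
      show "\<forall>\<^sub>F t in at_right t0. 0 \<le> Re (w t)"
        by (auto simp: eventually_at_filter re)
    qed simp
    have 3: "Re (w t0) \<le> 0"
    proof (rule tendsto_upperbound)
      show "((\<lambda>t. Re (w t)) \<longlongrightarrow> Re (w t0)) (at_left t0)"
        by (intro tendsto_intros lim)
      show "\<forall>\<^sub>F t in at_left t0. Re (w t) \<le> 0"
        by (auto simp: eventually_at_filter re)
    qed simp
    have "w t0 = 0"
      using 1 2 3 by (simp add: complex_eq_iff)
    moreover have "- cnj z = z"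
      by (simp add: z)
    ultimately show ?thesis
      by (simp add: w_def z)
  qed
  hence "[:cnj z, 1:] dvd r"
    by (simp add: poly_eq_0_iff_dvd)
  thus ?thesis
    by (simp only: r mult_dvd_mono dvd_refl)
qed

text \<open>Induction on the degree: removing a mirror pair lowers it by two and leaves a cofactor
  that is, up to sign, again nonnegative on the axis.\<close>

lemma poly_spectral_factorization:
  fixes p :: "complex poly"
  assumes "p \<noteq> 0" and "\<And>t::real. poly p (\<i> * of_real t) \<in> \<real>\<^sub>\<ge>\<^sub>0"
  shows "\<exists>q. (\<forall>t::real. poly p (\<i> * of_real t) = of_real ((norm (poly q (\<i> * of_real t)))\<^sup>2)) \<and>
             (\<forall>s. Re s < 0 \<longrightarrow> poly q s \<noteq> 0)"
  using assms
proof (induction "degree p" arbitrary: p rule: less_induct)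
  case (less p)
  show ?case
  proof (cases "degree p = 0")
    case True
    then obtain c where c: "p = [:c:]"
      by (rule degree_eq_zeroE)
    obtain x where x: "c = of_real x" "x \<ge> 0"
      using less.prems(2)[of 0] by (auto simp: c elim: nonneg_Reals_cases)
    show ?thesis
      using less.prems(1) x by (intro exI[of _ "[:of_real (sqrt x):]"]) (auto simp: c)
  next
    case False
    then obtain z0 where z0: "poly p z0 = 0"
      by (metis fundamental_theorem_of_algebra constant_degree)
    obtain z where z: "Re z \<ge> 0" and "[:-z, 1:] * [:cnj z, 1:] dvd p"
    proof (cases "Re z0 \<ge> 0")
      case True
      thus ?thesis
        using mirror_factor_dvd[OF less.prems(2) z0] that by blast
    next
      case False
      \<comment> \<open>The pair of factors is unchanged when z0 is replaced by its mirror image, so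
        the latter can serve as z.\<close>
      have "[:- (- cnj z0), 1:] * [:cnj (- cnj z0), 1:] dvd p"
        using mirror_factor_dvd[OF less.prems(2) z0] by (simp add: mult.commute)
      thus ?thesis
        using False that[of "- cnj z0"] by simp
    qed
    then obtain r' where r': "p = [:-z, 1:] * [:cnj z, 1:] * r'"
      by (elim dvdE)
    \<comment> \<open>The sign absorbs the minus from \<open>mirror_factor_axis\<close>, so that r
      is the nonnegative cofactor.\<close>
    define r where "r = - r'"
    have r: "poly p (\<i> * of_real t) = 
             of_real ((norm (\<i> * of_real t - z))\<^sup>2) * poly r (\<i> * of_real t)" for t
    proof -
      have "poly p (\<i> * of_real t) =
              (\<i> * of_real t - z) * (\<i> * of_real t + cnj z) * poly r' (\<i> * of_real t)"
        unfolding r' poly_mult by (simp add: add.commute)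
      thus ?thesis
        unfolding mirror_factor_axis by (simp add: r_def)
    qed
    have "r \<noteq> 0" "r' \<noteq> 0"
      using less.prems(1) by (auto simp: r' r_def)
    have "degree p = degree r + 2"
      unfolding r' using \<open>r' \<noteq> 0\<close> by (simp add: degree_mult_eq r_def del: mult_pCons_left mult_pCons_right)
    \<comment> \<open>The squared modulus can be cancelled except where it = z; that point is
      recovered by continuity.\<close>
    have "\<forall>\<^sub>F t::real in cofinite. poly r (\<i> * of_real t) \<in> \<real>\<^sub>\<ge>\<^sub>0"
      using eventually_cofinite_poly_axis_neq_0[of "[:-z, 1:]", simplified]
    proof eventually_elim
      case (elim t)
      hence "\<i> * of_real t - z \<noteq> 0"
        by (simp add: add_eq_0_iff)
      thus ?case
        using less.prems(2)[of t]
        by (auto simp: r complex_nonneg_Reals_iff zero_le_mult_iff simp flip: of_real_power)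
    qed
    note nonneg = eventually_cofinite_poly_axis_nonneg[OF this]
    obtain q where q: "\<And>t::real. poly r (\<i> * of_real t) = of_real ((norm (poly q (\<i> * of_real t)))\<^sup>2)"
        "\<And>s. Re s < 0 \<Longrightarrow> poly q s \<noteq> 0"
      using less.hyps[OF _ \<open>r \<noteq> 0\<close> nonneg] \<open>degree p = degree r + 2\<close> by auto
    have "poly p (\<i> * of_real t) = of_real ((norm (poly ([:-z, 1:] * q) (\<i> * of_real t)))\<^sup>2)" for t
    proof -
      have "poly ([:-z, 1:] * q) (\<i> * of_real t) = (\<i> * of_real t - z) * poly q (\<i> * of_real t)"
        by (simp add: algebra_simps)
      thus ?thesis
        by (simp only: r q(1) norm_mult power_mult_distrib of_real_mult)
    qed
    \<comment> \<open>The new factor vanishes only at z, which lies in the closed right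
      half-plane.\<close>
    moreover have "poly ([:-z, 1:] * q) s \<noteq> 0" if "Re s < 0" for s
      using q(2)[OF that] that z by auto
    ultimately show ?thesis by blast
  qed
qed

section \<open>Spectral factorization of rational functions in \<open>GPE\<close>\<close>

text \<open>The fraction a / b may be unreduced: roots of the reduced denominator are roots of b.
  This matters for spectral factors, whose numerator and denominator come from separate
  factorizations and may share roots.\<close>

lemma ratfun_eval_analytic_onI:
  assumes f: "f = to_fract a / to_fract b" and b: "\<And>s. s \<in> S \<Longrightarrow> poly b s \<noteq> 0" and "open S"
  shows "ratfun_eval f analytic_on S"
proof -
  have "(\<lambda>s. poly a s / poly b s) holomorphic_on S"
    using b by (intro holomorphic_intros) auto
  moreover have "ratfun_eval f s = poly a s / poly b s" if "s \<in> S" for s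
    using ratfun_eval_eqI[OF f b[OF that]] by simp
  ultimately show ?thesis
    using \<open>open S\<close> by (simp add: analytic_on_open cong: holomorphic_cong)
qed

text \<open>Writing \<open>f = a / b = a b\<^sup># / (b b\<^sup>#)\<close>, numerator and denominator are both nonnegative on the
  axis and are factored separately.\<close>

lemma GPE_spectral_factorization:
  assumes "f \<in> GPE" "f \<noteq> 0"
  shows "\<exists>h\<in>Gplus_bar. f = h * sharp h"
proof -
  define a b where "a = fst (quot_of_fract f)" and "b = snd (quot_of_fract f)"
  have "b \<noteq> 0" by (simp add: b_def)
  have "a \<noteq> 0"
    using ratfun_quot[of f] assms by (auto simp: a_def)
  have sharp_axis: "poly (poly_sharp b) (\<i> * of_real t) = cnj (poly b (\<i> * of_real t))" for t
    by (simp add: poly_poly_sharp)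
  have "poly_sharp b \<noteq> 0"
    using poly_eqI_axis[of b 0] \<open>b \<noteq> 0\<close> sharp_axis by force
  have *: "\<forall>\<^sub>F t::real in cofinite. poly (a * poly_sharp b) (\<i> * of_real t) \<in> \<real>\<^sub>\<ge>\<^sub>0"
    using assms(1)[unfolded GPE_iff] eventually_cofinite_poly_axis_neq_0[OF \<open>b \<noteq> 0\<close>]
  proof eventually_elim
    case (elim t)
    have "poly (a * poly_sharp b) (\<i> * of_real t) =
        axis_eval f t * of_real ((norm (poly b (\<i> * of_real t)))\<^sup>2)"
      using elim by (simp add: ratfun_eval_def sharp_axis complex_norm_square
          flip: a_def b_def del: of_real_power)
    also have "\<dots> \<in> \<real>\<^sub>\<ge>\<^sub>0"
      using elim by (intro nonneg_Reals_mult_I) (auto simp del: of_real_power)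
    finally show ?case .
  qed
  obtain q where q: "\<And>t::real. poly (a * poly_sharp b) (\<i> * of_real t) = of_real ((norm (poly q (\<i> * of_real t)))\<^sup>2)"
      "\<And>s. Re s < 0 \<Longrightarrow> poly q s \<noteq> 0"
    using poly_spectral_factorization[of "a * poly_sharp b"]
      eventually_cofinite_poly_axis_nonneg[OF *] \<open>a \<noteq> 0\<close> \<open>poly_sharp b \<noteq> 0\<close> by auto
  have bb: "poly (b * poly_sharp b) (\<i> * of_real t) = of_real ((norm (poly b (\<i> * of_real t)))\<^sup>2)" for t
    by (simp add: sharp_axis complex_norm_square del: of_real_power)
  have "poly (b * poly_sharp b) (\<i> * of_real t) \<in> \<real>\<^sub>\<ge>\<^sub>0" for t
    unfolding bb by (simp del: of_real_power)
  then obtain d where d: "\<And>t::real. poly (b * poly_sharp b) (\<i> * of_real t) = of_real ((norm (poly d (\<i> * of_real t)))\<^sup>2)"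
      "\<And>s. Re s < 0 \<Longrightarrow> poly d s \<noteq> 0"
    using poly_spectral_factorization[of "b * poly_sharp b"] \<open>b \<noteq> 0\<close> \<open>poly_sharp b \<noteq> 0\<close> by auto
  define h where "h = to_fract q / to_fract d"
  \<comment> \<open>The point -1 is a sample from the open left half-plane, where q and d have no
    roots.\<close>
  have "q \<noteq> 0" "d \<noteq> 0"
    using q(2)[of "-1"] d(2)[of "-1"] by auto
  have "f = h * sharp h"
  proof (rule ratfun_eqI_axis)
    show "\<forall>\<^sub>F t in cofinite. axis_eval f t = axis_eval (h * sharp h) t"
      using axis_eval_mult[of h "sharp h"] axis_eval_sharp[of h]
        eventually_cofinite_poly_axis_neq_0[OF \<open>b \<noteq> 0\<close>]
        eventually_cofinite_poly_axis_neq_0[OF \<open>d \<noteq> 0\<close>]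
    proof eventually_elim
      case (elim t)
      let ?s = "\<i> * of_real t"
      have "axis_eval f t = poly (a * poly_sharp b) ?s / poly (b * poly_sharp b) ?s"
        using elim by (simp add: ratfun_eval_def sharp_axis flip: a_def b_def)
      also have "\<dots> = of_real ((norm (poly q ?s))\<^sup>2) / of_real ((norm (poly d ?s))\<^sup>2)"
        by (simp only: q d)
      also have "\<dots> = axis_eval h t * cnj (axis_eval h t)"
        using ratfun_eval_eqI[OF h_def, of ?s] elim 
        by (simp add: complex_norm_square del: of_real_power)
      finally show ?case
        using elim by simp
    qed
  qed
  \<comment> \<open>Neither d nor q has a root in the open left half-plane, so both q / d and d / q
    are analytic there.\<close>
  moreover have "h \<in> Gplus_bar"
  proof -
    have inv: "inverse h = to_fract d / to_fract q"
      by (simp add: h_def)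
    have "open {s. Re s < 0}"
      by (simp add: open_halfspace_Re_lt)
    thus ?thesis
      unfolding Gplus_bar_def using \<open>q \<noteq> 0\<close> \<open>d \<noteq> 0\<close> q(2) d(2)
      by (auto intro!: ratfun_eval_analytic_onI[OF h_def] ratfun_eval_analytic_onI[OF inv])
         (simp add: h_def)
  qed
  ultimately show ?thesis by blast
qed

text \<open>On the axis the sum is a sum of squared moduli, which vanishes only termwise. Hence
  functions that are not all zero give a nonzero sum, to which spectral factorization
  applies.\<close>

lemma sum_mult_sharp_eq_0D:
  assumes "finite A" "(\<Sum>j\<in>A. g j * sharp (g j)) = 0" "j \<in> A"
  shows "g j = 0"
proof (rule ratfun_eqI_axis)
  have "\<forall>\<^sub>F t in cofinite. axis_eval (\<Sum>j\<in>A. g j * sharp (g j)) t = (\<Sum>j\<in>A. of_real ((norm (axis_eval (g j) t))\<^sup>2))"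
    using \<open>finite A\<close>
  proof (induction A rule: finite_induct)
    case (insert k A)
    from axis_eval_add[of "g k * sharp (g k)" "\<Sum>j\<in>A. g j * sharp (g j)"]
      axis_eval_mult[of "g k" "sharp (g k)"] axis_eval_sharp[of "g k"] insert.IH
    show ?case
      by eventually_elim (use insert.hyps in \<open>simp add: complex_norm_square del: of_real_power\<close>)
  qed simp
  thus "\<forall>\<^sub>F t in cofinite. axis_eval (g j) t = axis_eval 0 t"
  proof eventually_elim
    case (elim t)
    hence "(\<Sum>j\<in>A. (norm (axis_eval (g j) t))\<^sup>2) = 0"
      unfolding assms(2) by (simp flip: of_real_sum of_real_power)
    thus ?case
      using assms(1,3) by (simp add: sum_nonneg_eq_0_iff)
  qed
qed

section \<open>Composition with positive functions\<close>

text \<open>A boundary point is approached from the right, inside the open half-plane. The boundary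
  is needed because a \<open>GPE\<close> function can take the value 0 on the axis, for instance
  when it is the zero function.\<close>

lemma Pos_Re_nonneg:
  assumes p: "p \<in> Pos" and x: "Re x \<ge> 0" "\<not> is_pole (ratfun_eval p) x"
  shows "Re (ratfun_eval p x) \<ge> 0"
proof (rule tendsto_lowerbound)
  have lim: "filterlim (\<lambda>e. x + of_real e) (at x) (at_right 0)"
    by (rule filterlim_atI) (auto intro!: tendsto_eq_intros simp: eventually_at_filter)
  show "((\<lambda>e. Re (ratfun_eval p (x + of_real e))) \<longlongrightarrow> Re (ratfun_eval p x)) (at_right 0)"
    by (intro tendsto_Re filterlim_compose[OF ratfun_eval_tendsto[OF x(2)] lim])
  show "\<forall>\<^sub>F e in at_right 0. 0 \<le> Re (ratfun_eval p (x + of_real e))"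
  proof -
    have "0 \<le> Re (ratfun_eval p (x + of_real e))" if "e > 0" for e
      using p x(1) that by (simp add: Pos_def)
    thus ?thesis
      by (auto simp: eventually_at_filter)
  qed
qed simp

text \<open>Definedness says that the denominator of p with g substituted is a nonzero rational
  function. It is therefore nonzero at almost all points of the axis, where g(it) is then no pole of
  p.\<close>

lemma axis_eval_comp:
  assumes "ratfun_comp_defined p g"
  shows "\<forall>\<^sub>F t in cofinite. \<not> is_pole (ratfun_eval p) (axis_eval g t) \<and>
           axis_eval (ratfun_comp p g) t = ratfun_eval p (axis_eval g t)"
proof -
  have "poly_subst (snd (quot_of_fract p)) g \<noteq> 0"
    using assms by (simp add: ratfun_comp_defined_def)
  from eventually_cofinite_axis_eval_neq_0[OF this] eventually_cofinite_axis_not_pole[of g]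
  show ?thesis
  proof eventually_elim
    case (elim t)
    hence "\<not> is_pole (ratfun_eval p) (axis_eval g t)"
      using ratfun_eval_poly_subst[of g] by (simp add: is_pole_ratfun_iff)
    with elim show ?case
      using ratfun_eval_comp by blast
  qed
qed

lemma ratfun_comp_GP:
  assumes "p \<in> Pos" "g \<in> GPE" "ratfun_comp_defined p g"
  shows "ratfun_comp p g \<in> GP"
  using axis_eval_comp[OF assms(3)] assms(2) unfolding GPE_iff GP_iff
  by eventually_elim (use assms(1) in \<open>simp add: Pos_Re_nonneg complex_nonneg_Reals_iff\<close>)

lemma ratfun_comp_Even:
  assumes "leaves_real_axis_invariant p" "g \<in> Even" "ratfun_comp_defined p g"
  shows "ratfun_comp p g \<in> Even"
  using axis_eval_comp[OF assms(3)] assms(2) unfolding Even_iff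
  by eventually_elim (use assms(1) in \<open>auto simp: leaves_real_axis_invariant_def elim!: Reals_cases\<close>)

theorem proposition5p2:
  shows "(\<forall>\<psi>. \<psi> \<in> GP \<longleftrightarrow> even_part \<psi> \<in> GP) \<and>
    (GPE \<subseteq> GP \<and> convex_invertible_cone GPE) \<and>
    group \<lparr>carrier = (GP \<inter> Even) - {0}, monoid.mult = (*), one = 1\<rparr> \<and>
    (\<forall>g. g \<in> GPE \<longleftrightarrow> (\<lambda>\<psi>. g * \<psi>) ` GP \<subseteq> GP) \<and>
    (\<forall>(m::nat) (g :: nat \<Rightarrow> ratfun).
        1 \<le> m \<and> (\<forall>j\<in>{1..m}. g j * sharp (g j) \<in> GPE) \<longrightarrow>
          (\<exists>h. h * sharp h \<in> GPE \<and> (\<Sum>j=1..m. g j * sharp (g j)) = h * sharp h) \<and>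
          ((\<exists>j\<in>{1..m}. g j \<noteq> 0) \<longrightarrow>
             (\<exists>h\<in>Gplus_bar. h * sharp h \<in> GPE \<and> (\<Sum>j=1..m. g j * sharp (g j)) = h * sharp h))) \<and>
    (\<forall>p\<in>Pos. \<forall>g\<in>GPE. ratfun_comp_defined p g \<longrightarrow>
        ratfun_comp p g \<in> GP \<and>
        (leaves_real_axis_invariant p \<longrightarrow> ratfun_comp p g \<in> GPE))"
proof (intro conjI)
  show "\<forall>(m::nat) (g :: nat \<Rightarrow> ratfun).
        1 \<le> m \<and> (\<forall>j\<in>{1..m}. g j * sharp (g j) \<in> GPE) \<longrightarrow>
          (\<exists>h. h * sharp h \<in> GPE \<and> (\<Sum>j=1..m. g j * sharp (g j)) = h * sharp h) \<and>
          ((\<exists>j\<in>{1..m}. g j \<noteq> 0) \<longrightarrow>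
             (\<exists>h\<in>Gplus_bar. h * sharp h \<in> GPE \<and> (\<Sum>j=1..m. g j * sharp (g j)) = h * sharp h))"
  proof (intro allI impI, elim conjE)
    fix m :: nat and g :: "nat \<Rightarrow> ratfun"
    assume "\<forall>j\<in>{1..m}. g j * sharp (g j) \<in> GPE"
    define f where "f = (\<Sum>j=1..m. g j * sharp (g j))"
    have f: "f \<in> GPE"
      unfolding f_def using \<open>\<forall>j\<in>{1..m}. g j * sharp (g j) \<in> GPE\<close> by (intro GPE_sum) blast
    have "\<exists>h\<in>Gplus_bar. h * sharp h \<in> GPE \<and> f = h * sharp h" if "f \<noteq> 0"
      using GPE_spectral_factorization[OF f that] f by auto
    \<comment> \<open>\<open>Gplus_bar\<close> excludes the zero function, so a vanishing sum is
      represented by h = 0 instead.\<close>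
    moreover have "\<exists>h. h * sharp h \<in> GPE \<and> f = h * sharp h" if "f = 0"
      using that GPE_0 by (intro exI[of _ 0]) simp
    moreover have "f \<noteq> 0" if "\<exists>j\<in>{1..m}. g j \<noteq> 0"
      unfolding f_def using that sum_mult_sharp_eq_0D[OF finite_atLeastAtMost] by blast
    ultimately show "(\<exists>h. h * sharp h \<in> GPE \<and> (\<Sum>j=1..m. g j * sharp (g j)) = h * sharp h) \<and>
          ((\<exists>j\<in>{1..m}. g j \<noteq> 0) \<longrightarrow>
             (\<exists>h\<in>Gplus_bar. h * sharp h \<in> GPE \<and> (\<Sum>j=1..m. g j * sharp (g j)) = h * sharp h))"
      unfolding f_def[symmetric] by blast
  qed
  show "group \<lparr>carrier = (GP \<inter> Even) - {0}, monoid.mult = (*), one = 1\<rparr>"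
    using group_GPE by (simp add: GPE_def)
  show "\<forall>\<psi>. \<psi> \<in> GP \<longleftrightarrow> even_part \<psi> \<in> GP"
    using GP_iff_even_part by blast
  show "GPE \<subseteq> GP"
    by (auto simp: GPE_def)
  show "\<forall>g. g \<in> GPE \<longleftrightarrow> (\<lambda>\<psi>. g * \<psi>) ` GP \<subseteq> GP"
    using GPE_iff_multiplier by blast
  show "\<forall>p\<in>Pos. \<forall>g\<in>GPE. ratfun_comp_defined p g \<longrightarrow>
        ratfun_comp p g \<in> GP \<and>
        (leaves_real_axis_invariant p \<longrightarrow> ratfun_comp p g \<in> GPE)"
    using ratfun_comp_GP ratfun_comp_Even by (auto simp: GPE_def)
qed (rule convex_invertible_cone_GPE)

end
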